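(* Let $\mathcal F=(V,E,\phi)$ be a framework. If there is a dependent subset of vertices $S\subseteq V$ whose pinning closure covers all vertices, i.e. $\mathrm{cl}_{\mathrm{pin}}(S)=V$, then $\mathcal F$ is indecomposable.
   Context: A framework in $\mathbb R^d$ ($d\ge 1$) is a triple $\mathcal F=(V,E,\phi)$ with $V$ a finite set (vertices), $E\subseteq\binom{V}{2}$ (edges), and $\phi:V\to\mathbb R^d$, $v\mapsto\phi_v$. A pair $uv$ is degenerate if $\phi_u=\phi_v$, non-degenerate otherwise. A framework $\mathcal G=(V,E,\psi)$ in $\mathbb R^d$ on the same graph is a deformation of $\mathcal F$ if for every $uv\in E$ there is $\lambda_{uv}\ge 0$ with $\psi_v-\psi_u=\lambda_{uv}(\phi_v-\phi_u)$. Indecomposability: a connected framework $\mathcal F$ (i.e. the graph $(V,E)$ is connected) is indecomposable if for every deformation $(V,E,\psi)$ there are $\alpha\ge0$ and $t\in\mathbb R^d$ with $\psi_v=\alpha\phi_v+t$ for all $v\in V$. By convention a disconnected framework is decomposable. Implicit edges: a pair $u,v\in V$ is an implicit edge of $\mathcal F$ if for every deformation $(V,E,\psi)$ of $\mathcal F$ there is $\lambda_{uv}\ge0$ with $\psi_v-\psi_u=\lambda_{uv}(\phi_v-\phi_u)$ (every edge is an implicit edge). Two non-degenerate implicit edges are dependent if their coefficients $\lambda$ coincide for every deformation of $\mathcal F$. A subset $S\subseteq V$ is dependent if every pair of vertices of $S$ is an implicit edge and the non-degenerate ones among these are pairwise dependent. Pinning: a flat of $\mathcal F$ is a subset $F\subseteq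 V$ such that any two vertices of $F$ are joined by a path of edges of $\mathcal F$ using only vertices in $F$. Its direction is $\mathrm{dir}(F)=\mathrm{lin}\{\phi_u-\phi_v : u,v\in F\}$. A collection $\mathcal C$ of flats pins a vertex $v$ if there is a subset $\mathcal I\subseteq\mathcal C$ with $v\in\bigcap_{F\in\mathcal I}F$ and $\bigcap_{F\in\mathcal I}\mathrm{dir}(F)=\{0\}$. It is grounded on $S\subseteq V$ if every flat of $\mathcal C$ contains some vertex of $S$. The pinning closure of $S$: put $S_0=S$ and $S_i=S_{i-1}\cup\{v\in V: v\text{ is pinned by a collection of flats grounded on }S_{i-1}\}$ for $i\geq 1$; the sequence stabilizes, and $\mathrm{cl}_{\mathrm{pin}}(S)$ is the stable set. *)

theory Defs
  imports "HOL-Analysis.Analysis"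
begin

text \<open>
  A framework in \<open>\<real>\<^sup>d\<close> is given by its vertex set, its set of two-element edges and a
  placement map; only the values of the placement map on the vertex set matter. The dimension
  is the cardinality of the index type \<open>'d\<close>, hence at least 1.
\<close>

definition framework :: "'v set \<Rightarrow> 'v set set \<Rightarrow> ('v \<Rightarrow> real ^ 'd) \<Rightarrow> bool" where
  "framework V E \<phi> \<longleftrightarrow> finite V \<and> E \<subseteq> {e. e \<subseteq> V \<and> card e = 2}"

definition degenerate :: "('v \<Rightarrow> real ^ 'd) \<Rightarrow> 'v \<Rightarrow> 'v \<Rightarrow> bool" where
  "degenerate \<phi> u v \<longleftrightarrow> \<phi> u = \<phi> v"

definition deformation :: "'v set set \<Rightarrow> ('v \<Rightarrow> real ^ 'd) \<Rightarrow> ('v \<Rightarrow> real ^ 'd) \<Rightarrow> bool" where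
  "deformation E \<phi> \<psi> \<longleftrightarrow>
     (\<forall>u v. {u, v} \<in> E \<longrightarrow> (\<exists>c\<ge>0. \<psi> v - \<psi> u = c *\<^sub>R (\<phi> v - \<phi> u)))"

definition joined_within :: "'v set set \<Rightarrow> 'v set \<Rightarrow> 'v \<Rightarrow> 'v \<Rightarrow> bool" where
  "joined_within E F u v \<longleftrightarrow> (u, v) \<in> {(x, y). x \<in> F \<and> y \<in> F \<and> {x, y} \<in> E}\<^sup>*"

definition connected_graph :: "'v set \<Rightarrow> 'v set set \<Rightarrow> bool" where
  "connected_graph V E \<longleftrightarrow> (\<forall>u\<in>V. \<forall>v\<in>V. joined_within E V u v)"

definition indecomposable :: "'v set \<Rightarrow> 'v set set \<Rightarrow> ('v \<Rightarrow> real ^ 'd) \<Rightarrow> bool" where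
  "indecomposable V E \<phi> \<longleftrightarrow>
     connected_graph V E \<and>
     (\<forall>\<psi>. deformation E \<phi> \<psi> \<longrightarrow> (\<exists>\<alpha>\<ge>0. \<exists>t. \<forall>v\<in>V. \<psi> v = \<alpha> *\<^sub>R \<phi> v + t))"

definition implicit_edge :: "'v set \<Rightarrow> 'v set set \<Rightarrow> ('v \<Rightarrow> real ^ 'd) \<Rightarrow> 'v \<Rightarrow> 'v \<Rightarrow> bool" where
  "implicit_edge V E \<phi> u v \<longleftrightarrow>
     u \<in> V \<and> v \<in> V \<and>
     (\<forall>\<psi>. deformation E \<phi> \<psi> \<longrightarrow> (\<exists>c\<ge>0. \<psi> v - \<psi> u = c *\<^sub>R (\<phi> v - \<phi> u)))"

text \<open>
  For a non-degenerate implicit edge the coefficient belonging to a given deformation is unique,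
  so for two such edges a common coefficient exists iff their coefficients coincide.
\<close>

definition dependent_edges ::
    "'v set set \<Rightarrow> ('v \<Rightarrow> real ^ 'd) \<Rightarrow> 'v \<Rightarrow> 'v \<Rightarrow> 'v \<Rightarrow> 'v \<Rightarrow> bool" where
  "dependent_edges E \<phi> u v x y \<longleftrightarrow>
     (\<forall>\<psi>. deformation E \<phi> \<psi> \<longrightarrow>
        (\<exists>c\<ge>0. \<psi> v - \<psi> u = c *\<^sub>R (\<phi> v - \<phi> u) \<and> \<psi> y - \<psi> x = c *\<^sub>R (\<phi> y - \<phi> x)))"

definition dependent_vertices ::
    "'v set \<Rightarrow> 'v set set \<Rightarrow> ('v \<Rightarrow> real ^ 'd) \<Rightarrow> 'v set \<Rightarrow> bool" where
  "dependent_vertices V E \<phi> S \<longleftrightarrow>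
     S \<subseteq> V \<and>
     (\<forall>u\<in>S. \<forall>v\<in>S. implicit_edge V E \<phi> u v) \<and>
     (\<forall>u\<in>S. \<forall>v\<in>S. \<forall>x\<in>S. \<forall>y\<in>S.
        \<not> degenerate \<phi> u v \<longrightarrow> \<not> degenerate \<phi> x y \<longrightarrow> dependent_edges E \<phi> u v x y)"

definition flat :: "'v set \<Rightarrow> 'v set set \<Rightarrow> 'v set \<Rightarrow> bool" where
  "flat V E F \<longleftrightarrow> F \<subseteq> V \<and> (\<forall>u\<in>F. \<forall>v\<in>F. joined_within E F u v)"

definition direction :: "('v \<Rightarrow> real ^ 'd) \<Rightarrow> 'v set \<Rightarrow> (real ^ 'd) set" where
  "direction \<phi> F = span {\<phi> u - \<phi> v | u v. u \<in> F \<and> v \<in> F}"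

text \<open>
  The subcollection \<open>I\<close> is allowed to be empty, but then the intersection of directions is the
  whole space, which is not \<open>{0}\<close> because the dimension is positive.
\<close>

definition pins :: "('v \<Rightarrow> real ^ 'd) \<Rightarrow> 'v set set \<Rightarrow> 'v \<Rightarrow> bool" where
  "pins \<phi> C v \<longleftrightarrow> (\<exists>I\<subseteq>C. v \<in> (\<Inter>F\<in>I. F) \<and> (\<Inter>F\<in>I. direction \<phi> F) = {0})"

definition grounded :: "'v set set \<Rightarrow> 'v set \<Rightarrow> bool" where
  "grounded C S \<longleftrightarrow> (\<forall>F\<in>C. F \<inter> S \<noteq> {})"

primrec pin_stage ::
    "'v set \<Rightarrow> 'v set set \<Rightarrow> ('v \<Rightarrow> real ^ 'd) \<Rightarrow> 'v set \<Rightarrow> nat \<Rightarrow> 'v set" where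
  "pin_stage V E \<phi> S 0 = S"
| "pin_stage V E \<phi> S (Suc i) = pin_stage V E \<phi> S i \<union>
     {v \<in> V. \<exists>C. (\<forall>F\<in>C. flat V E F) \<and> grounded C (pin_stage V E \<phi> S i) \<and> pins \<phi> C v}"

text \<open>
  The stages increase and are eventually constant; their union is the stable set
  (lemma \<open>pin_closure_stable\<close>).
\<close>

definition pin_closure ::
    "'v set \<Rightarrow> 'v set set \<Rightarrow> ('v \<Rightarrow> real ^ 'd) \<Rightarrow> 'v set \<Rightarrow> 'v set" where
  "pin_closure V E \<phi> S = (\<Union>i. pin_stage V E \<phi> S i)"

lemma pin_stage_mono: "i \<le> j \<Longrightarrow> pin_stage V E \<phi> S i \<subseteq> pin_stage V E \<phi> S j"
  by (rule lift_Suc_mono_le) auto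

lemma pin_stage_subset: "S \<subseteq> V \<Longrightarrow> pin_stage V E \<phi> S i \<subseteq> V"
  by (induction i) auto

lemma pin_closure_stable:
  assumes "framework V E \<phi>" and "S \<subseteq> V"
  shows "\<exists>n. \<forall>m\<ge>n. pin_stage V E \<phi> S m = pin_closure V E \<phi> S"
proof -
  have "finite (pin_closure V E \<phi> S)"
    using assms pin_stage_subset[OF assms(2)] unfolding framework_def pin_closure_def
    by (meson UN_least finite_subset)
  moreover have "\<forall>v \<in> pin_closure V E \<phi> S. \<exists>i. v \<in> pin_stage V E \<phi> S i"
    by (auto simp: pin_closure_def)
  then obtain f where f: "\<And>v. v \<in> pin_closure V E \<phi> S \<Longrightarrow> v \<in> pin_stage V E \<phi> S (f v)"
    by metis
  ultimately obtain n where n: "\<And>v. v \<in> pin_closure V E \<phi> S \<Longrightarrow> f v \<le> n"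
    by (metis finite_imageI finite_nat_set_iff_bounded_le imageI)
  have "pin_stage V E \<phi> S m = pin_closure V E \<phi> S" if "n \<le> m" for m
  proof
    show "pin_stage V E \<phi> S m \<subseteq> pin_closure V E \<phi> S"
      by (auto simp: pin_closure_def)
    show "pin_closure V E \<phi> S \<subseteq> pin_stage V E \<phi> S m"
      using f n that pin_stage_mono by (meson le_trans subset_iff)
  qed
  then show ?thesis by blast
qed

end

theory Submission
  imports Defs
begin

text \<open>
  For connectedness, translating a single connected component is a deformation, so an implicit edge
  cannot join two components, and pinning only adds vertices joined to earlier ones. For rigidity,
  subtract from a deformation \<open>\<psi>\<close> the multiple \<open>\<alpha> \<phi>\<close>, where \<open>\<alpha>\<close> is the common coefficient
  on \<open>S\<close>. The difference is constant on \<open>S\<close>, and along any flat it varies only within the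
  direction of that flat; hence a pinned vertex receives the same constant.
\<close>

lemma joined_within_refl: "joined_within E F u u"
  by (simp add: joined_within_def)

lemma joined_within_trans:
  "joined_within E F u v \<Longrightarrow> joined_within E F v w \<Longrightarrow> joined_within E F u w"
  unfolding joined_within_def by (rule rtrancl_trans)

lemma joined_within_sym:
  assumes "joined_within E F u v"
  shows "joined_within E F v u"
proof -
  have "sym {(x, y). x \<in> F \<and> y \<in> F \<and> {x, y} \<in> E}"
    by (auto simp: sym_def insert_commute)
  then show ?thesis
    using assms unfolding joined_within_def by (blast dest: sym_rtrancl symD)
qed

lemma joined_within_mono:
  assumes "joined_within E F u v" and "F \<subseteq> G"
  shows "joined_within E G u v"
proof -
  have "{(x, y). x \<in> F \<and> y \<in> F \<and> {x, y} \<in> E} \<subseteq> {(x, y). x \<in> G \<and> y \<in> G \<and> {x, y} \<in> E}"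
    using assms(2) by auto
  then show ?thesis
    using assms(1) unfolding joined_within_def by (meson rtrancl_mono subsetD)
qed

lemma joined_within_edge:
  "{a, b} \<in> E \<Longrightarrow> a \<in> F \<Longrightarrow> b \<in> F \<Longrightarrow> joined_within E F a b"
  unfolding joined_within_def by auto

text \<open>No edge leaves a connected component, so both ends of an edge move by \<open>t\<close>
  or neither does. Every edge vector is unchanged and the coefficient 1 works.\<close>

lemma deformation_translate_component:
  assumes "framework V E \<phi>"
  shows "deformation E \<phi> (\<lambda>w. if joined_within E V u w then \<phi> w + t else \<phi> w)"
  unfolding deformation_def
proof (intro allI impI)
  fix a b assume ab: "{a, b} \<in> E"
  then have "joined_within E V a b"
    using assms by (intro joined_within_edge) (auto simp: framework_def)
  then have "joined_within E V u a \<longleftrightarrow> joined_within E V u b"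
    by (meson joined_within_trans joined_within_sym)
  then show "\<exists>c\<ge>0. (if joined_within E V u b then \<phi> b + t else \<phi> b)
      - (if joined_within E V u a then \<phi> a + t else \<phi> a) = c *\<^sub>R (\<phi> b - \<phi> a)"
    by (intro exI[of _ 1]) auto
qed

lemma implicit_edge_joined:
  assumes "framework V E \<phi>" and "implicit_edge V E \<phi> u v"
  shows "joined_within E V u v"
proof (rule ccontr)
  assume not_joined: "\<not> joined_within E V u v"
  have translated: "\<exists>c\<ge>0. \<phi> v - (\<phi> u + t) = c *\<^sub>R (\<phi> v - \<phi> u)" for t
    using assms(2) deformation_translate_component[OF assms(1), of u t] not_joined
      joined_within_refl[of E V u]
    unfolding implicit_edge_def by fastforce
  show False
  proof (cases "\<phi> u = \<phi> v")
    case True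
    \<comment> \<open>Here any nonzero translation gives the contradiction; \<open>1\<close> is the
      all-ones vector.\<close>
    then show False using translated[of 1] by simp
  next
    case False
    \<comment> \<open>This translation carries \<open>u\<close> past \<open>v\<close> and reverses
      the vector between them, so the coefficient would have to be -1.\<close>
    obtain c where c: "c \<ge> 0" "\<phi> v - (\<phi> u + 2 *\<^sub>R (\<phi> v - \<phi> u)) = c *\<^sub>R (\<phi> v - \<phi> u)"
      using translated by blast
    then have "(c + 1) *\<^sub>R (\<phi> v - \<phi> u) = 0"
      by (simp add: algebra_simps scaleR_2)
    with c(1) False show False by simp
  qed
qed

text \<open>The subcollection is nonempty because an empty intersection of directions would be everything.\<close>

lemma pinsE:
  fixes \<phi> :: "'v \<Rightarrow> real ^ 'd"
  assumes "pins \<phi> C v"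
  obtains I where "I \<subseteq> C" and "I \<noteq> {}" and "\<And>F. F \<in> I \<Longrightarrow> v \<in> F"
    and "(\<Inter>F\<in>I. direction \<phi> F) = {0}"
proof -
  obtain I where I: "I \<subseteq> C" "v \<in> (\<Inter>F\<in>I. F)" "(\<Inter>F\<in>I. direction \<phi> F) = {0}"
    using assms unfolding pins_def by blast
  have "(1 :: real ^ 'd) \<notin> {0}" by simp
  with I(3) have "I \<noteq> {}" by auto
  with I show ?thesis by (intro that) auto
qed

text \<open>Induction on the stage, with the stage replaced by an arbitrary set \<open>T\<close> on
  which \<open>P\<close> already holds. Later arguments can then ignore stage indices.\<close>

lemma pin_closure_induct [consumes 1, case_names base pinned]:
  assumes "v \<in> pin_closure V E \<phi> S"
    and "\<And>v. v \<in> S \<Longrightarrow> P v"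
    and "\<And>v C T. v \<in> V \<Longrightarrow> (\<And>w. w \<in> T \<Longrightarrow> P w) \<Longrightarrow> (\<And>F. F \<in> C \<Longrightarrow> flat V E F) \<Longrightarrow>
      grounded C T \<Longrightarrow> pins \<phi> C v \<Longrightarrow> P v"
  shows "P v"
proof -
  have "\<forall>w \<in> pin_stage V E \<phi> S i. P w" for i
  proof (induction i)
    case (Suc i)
    then show ?case using assms(3)[where T = "pin_stage V E \<phi> S i"] by auto
  qed (use assms(2) in auto)
  then show ?thesis using assms(1) by (auto simp: pin_closure_def)
qed

text \<open>A pinned vertex needs at least one flat, and that flat needs a grounding vertex, so
  nothing can start from the empty set.\<close>

lemma pin_closure_empty: "pin_closure V E \<phi> {} = {}"
proof -
  have False if "v \<in> pin_closure V E \<phi> {}" for v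
    using that
  proof (induction rule: pin_closure_induct)
    case (pinned v C T)
    obtain F where "F \<in> C"
      using pinned.hyps(4) by (elim pinsE) blast
    with pinned.IH pinned.hyps(3) show False unfolding grounded_def by blast
  qed simp
  then show ?thesis by blast
qed

text \<open>A pinned vertex shares a flat with an earlier vertex, and a flat is connected by paths
  inside \<open>V\<close>.\<close>

lemma pin_closure_joined:
  assumes "v \<in> pin_closure V E \<phi> S" and "\<And>w. w \<in> S \<Longrightarrow> joined_within E V s w"
  shows "joined_within E V s v"
  using assms(1)
proof (induction rule: pin_closure_induct)
  case (base v)
  then show ?case by (rule assms(2))
next
  case (pinned v C T)
  obtain F where F: "F \<in> C" "v \<in> F"
    using pinned.hyps(4) by (elim pinsE) blast
  obtain w where w: "w \<in> F" "w \<in> T"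
    using pinned.hyps(3) F unfolding grounded_def by blast
  have "joined_within E F w v" and "F \<subseteq> V"
    using pinned.hyps(2) F w unfolding flat_def by blast+
  then show ?case
    using pinned.IH w(2) joined_within_mono joined_within_trans by metis
qed

text \<open>Sum the increments of \<open>\<delta>\<close> along the path. The sign of
  \<open>c\<close> is left free because \<delta> will be a deformation minus a multiple of
  \<phi>.\<close>

lemma joined_within_diff_in_direction:
  assumes "joined_within E F u v"
    and edge: "\<And>a b. {a, b} \<in> E \<Longrightarrow> \<exists>c. \<delta> b - \<delta> a = c *\<^sub>R (\<phi> b - \<phi> a)"
  shows "\<delta> v - \<delta> u \<in> direction \<phi> F"
  using assms(1) unfolding joined_within_def
proof (induction rule: rtrancl_induct)
  case base
  then show ?case by (simp add: direction_def span_zero)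
next
  case (step y z)
  then obtain c where c: "\<delta> z - \<delta> y = c *\<^sub>R (\<phi> z - \<phi> y)" using edge by blast
  have "\<delta> z - \<delta> y \<in> direction \<phi> F"
    unfolding c direction_def using step(2) by (intro span_scale span_base) auto
  then have "(\<delta> z - \<delta> y) + (\<delta> y - \<delta> u) \<in> direction \<phi> F"
    using step(3) unfolding direction_def by (rule span_add)
  then show ?case by simp
qed

text \<open>The grounding vertex may differ from flat to flat, but \<delta> has the same value
  \<open>t\<close> at each of them. Hence \<open>\<delta> v - t\<close> lies in every direction of
  the pinning flats at once, so it is zero.\<close>

lemma pin_closure_constant:
  assumes "v \<in> pin_closure V E \<phi> S"
    and edge: "\<And>a b. {a, b} \<in> E \<Longrightarrow> \<exists>c. \<delta> b - \<delta> a = c *\<^sub>R (\<phi> b - \<phi> a)"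
    and base: "\<And>s. s \<in> S \<Longrightarrow> \<delta> s = t"
  shows "\<delta> v = t"
  using assms(1)
proof (induction rule: pin_closure_induct)
  case (base v)
  then show ?case by (rule assms(3))
next
  case (pinned v C T)
  obtain I where I: "I \<subseteq> C" "\<And>F. F \<in> I \<Longrightarrow> v \<in> F" "(\<Inter>F\<in>I. direction \<phi> F) = {0}"
    using pinned.hyps(4) by (rule pinsE) blast
  have "\<delta> v - t \<in> direction \<phi> F" if "F \<in> I" for F
  proof -
    have "F \<in> C" using I(1) that by blast
    then obtain w where w: "w \<in> F" "w \<in> T"
      using pinned.hyps(3) unfolding grounded_def by blast
    have "joined_within E F w v"
      using pinned.hyps(2)[OF \<open>F \<in> C\<close>] I(2)[OF that] w(1) by (simp add: flat_def)
    then have "\<delta> v - \<delta> w \<in> direction \<phi> F"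
      using edge by (rule joined_within_diff_in_direction)
    then show ?thesis using pinned.IH[OF w(2)] by simp
  qed
  then have "\<delta> v - t \<in> {0}" unfolding I(3)[symmetric] by blast
  then show ?case by simp
qed

text \<open>Dependence only compares two pairs at a time. Fixing one non-degenerate reference pair
  in \<open>S\<close> yields a coefficient for all of \<open>S\<close>; on degenerate pairs both
  sides vanish.\<close>

lemma dependent_vertices_coefficient:
  assumes "dependent_vertices V E \<phi> S" and "deformation E \<phi> \<psi>"
  obtains \<alpha> where "\<alpha> \<ge> 0"
    and "\<And>x y. x \<in> S \<Longrightarrow> y \<in> S \<Longrightarrow> \<psi> y - \<psi> x = \<alpha> *\<^sub>R (\<phi> y - \<phi> x)"
proof -
  have degenerate_diff: "\<psi> y - \<psi> x = 0" if "x \<in> S" "y \<in> S" "\<phi> x = \<phi> y" for x y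
  proof -
    have "implicit_edge V E \<phi> x y"
      using assms(1) that(1,2) unfolding dependent_vertices_def by blast
    then obtain c where "\<psi> y - \<psi> x = c *\<^sub>R (\<phi> y - \<phi> x)"
      using assms(2) unfolding implicit_edge_def by blast
    then show ?thesis using that(3) by simp
  qed
  show ?thesis
  proof (cases "\<exists>u\<in>S. \<exists>v\<in>S. \<phi> u \<noteq> \<phi> v")
    case True
    then obtain u v where uv: "u \<in> S" "v \<in> S" "\<phi> u \<noteq> \<phi> v" by blast
    have "implicit_edge V E \<phi> u v"
      using assms(1) uv(1,2) unfolding dependent_vertices_def by blast
    then obtain \<alpha> where \<alpha>: "\<alpha> \<ge> 0" "\<psi> v - \<psi> u = \<alpha> *\<^sub>R (\<phi> v - \<phi> u)"
      using assms(2) unfolding implicit_edge_def by blast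
    show ?thesis
    proof (rule that[OF \<alpha>(1)])
      fix x y assume xy: "x \<in> S" "y \<in> S"
      show "\<psi> y - \<psi> x = \<alpha> *\<^sub>R (\<phi> y - \<phi> x)"
      proof (cases "\<phi> x = \<phi> y")
        case True
        then show ?thesis using degenerate_diff[OF xy True] by simp
      next
        case False
        then have "dependent_edges E \<phi> u v x y"
          using assms(1) uv xy by (simp add: dependent_vertices_def degenerate_def)
        then obtain c where "\<psi> v - \<psi> u = c *\<^sub>R (\<phi> v - \<phi> u)"
          and c: "\<psi> y - \<psi> x = c *\<^sub>R (\<phi> y - \<phi> x)"
          using assms(2) unfolding dependent_edges_def by blast
        \<comment> \<open>The reference pair is non-degenerate, so its coefficient for \<psi> is
          unique.\<close>
        with \<alpha>(2) uv(3) have "c = \<alpha>" by simp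
        with c show ?thesis by simp
      qed
    qed
  next
    case False
    show ?thesis
    \<comment> \<open>All of \<open>S\<close> sits at one point, so any nonnegative coefficient
      would do.\<close>
    proof (rule that[of 0])
      fix x y assume xy: "x \<in> S" "y \<in> S"
      with False have "\<phi> x = \<phi> y" by blast
      then show "\<psi> y - \<psi> x = 0 *\<^sub>R (\<phi> y - \<phi> x)"
        using degenerate_diff[OF xy] by simp
    qed simp
  qed
qed

theorem theorem1:
  fixes V :: "'v set" and E :: "'v set set" and \<phi> :: "'v \<Rightarrow> real ^ 'd" and S :: "'v set"
  assumes "framework V E \<phi>"
    and "S \<subseteq> V"
    and "dependent_vertices V E \<phi> S"
    and "pin_closure V E \<phi> S = V"
  shows "indecomposable V E \<phi>"
  unfolding indecomposable_def
proof (intro conjI allI impI)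
  have from_S: "joined_within E V s v" if "s \<in> S" "v \<in> V" for s v
  proof (rule pin_closure_joined)
    show "v \<in> pin_closure V E \<phi> S" using assms(4) that(2) by simp
    show "joined_within E V s w" if "w \<in> S" for w
      using assms(1,3) \<open>s \<in> S\<close> that
      by (intro implicit_edge_joined) (auto simp: dependent_vertices_def)
  qed
  show "connected_graph V E"
    unfolding connected_graph_def
  proof (intro ballI)
    fix u v assume uv: "u \<in> V" "v \<in> V"
    \<comment> \<open>The vertex \<open>u\<close> lies in the closure of \<open>S\<close>, so
      \<open>S\<close> has a vertex through which to route the path from \<open>u\<close> to
      \<open>v\<close>.\<close>
    then have "S \<noteq> {}" using assms(4) pin_closure_empty[of V E \<phi>] by auto
    then obtain s where "s \<in> S" by blast
    then show "joined_within E V u v"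
      using from_S uv joined_within_sym joined_within_trans by metis
  qed
next
  fix \<psi> assume \<psi>: "deformation E \<phi> \<psi>"
  obtain \<alpha> where \<alpha>: "\<alpha> \<ge> 0"
    "\<And>x y. x \<in> S \<Longrightarrow> y \<in> S \<Longrightarrow> \<psi> y - \<psi> x = \<alpha> *\<^sub>R (\<phi> y - \<phi> x)"
    using dependent_vertices_coefficient[OF assms(3) \<psi>] by blast
  define \<delta> where "\<delta> w = \<psi> w - \<alpha> *\<^sub>R \<phi> w" for w
  have edge: "\<exists>c. \<delta> b - \<delta> a = c *\<^sub>R (\<phi> b - \<phi> a)" if ab: "{a, b} \<in> E" for a b
  proof -
    obtain c where "\<psi> b - \<psi> a = c *\<^sub>R (\<phi> b - \<phi> a)"
      using \<psi> ab unfolding deformation_def by blast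
    then have "\<delta> b - \<delta> a = (c - \<alpha>) *\<^sub>R (\<phi> b - \<phi> a)"
      by (simp add: \<delta>_def algebra_simps)
    then show ?thesis by blast
  qed
  obtain t where t: "\<And>s. s \<in> S \<Longrightarrow> \<delta> s = t"
  \<comment> \<open>For empty \<open>S\<close> any \<open>t\<close> qualifies; otherwise the value
    of \<delta> at one vertex of \<open>S\<close> serves, by the choice of \<alpha>.\<close>
  proof (cases "S = {}")
    case False
    then obtain s0 where s0: "s0 \<in> S" by blast
    show ?thesis
      by (rule that[of "\<delta> s0"]) (use \<alpha>(2)[OF s0] in \<open>simp add: \<delta>_def algebra_simps\<close>)
  qed auto
  have "\<delta> v = t" if "v \<in> V" for v
  proof (rule pin_closure_constant[OF _ edge t])
    show "v \<in> pin_closure V E \<phi> S" using assms(4) that by simp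
  qed
  then have "\<forall>v\<in>V. \<psi> v = \<alpha> *\<^sub>R \<phi> v + t"
    by (simp add: \<delta>_def algebra_simps)
  with \<alpha>(1) show "\<exists>\<alpha>\<ge>0. \<exists>t. \<forall>v\<in>V. \<psi> v = \<alpha> *\<^sub>R \<phi> v + t" by blast
qed

end
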